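(* Let $G$ be a connected graph on $n\geq 14$ vertices and $m$ edges with minimum degree $\delta\geq 3$. If $$m\geq \binom{n-2}{2}+4,$$ then $G$ is Hamilton-connected unless $G\in \left(\bigcup_{i=0}^{2}\mathcal{S}_{n}^{3}(i)\right)\cup\left(\bigcup_{i=0}^{1}\mathcal{T}_{n}^{3}(i)\right)$, or $n=14$ and $G=S_{14}^{7}$.
   Context: All graphs are finite and simple (no loops or multiple edges); equality of graphs and membership in a family of graphs are up to isomorphism. $\delta=\delta(G)$ is the minimum degree of $G$. A Hamilton path is a path containing all vertices of $G$; $G$ is Hamilton-connected if every two (distinct) vertices of $G$ are connected by a Hamilton path. $G+H$ and $G\vee H$ denote the disjoint union and the join of $G$ and $H$; $kG$ is the disjoint union of $k$ copies of $G$; $K_n$ is the complete graph on $n$ vertices. For $n\geq 5$ and $1\leq k\leq n/2$, define $$S_{n}^{k}=K_{k}\vee (K_{n-(2k-1)}+(k-1)K_{1}),\qquad T_{n}^{k}=K_{2}\vee (K_{n-(k+1)}+K_{k-1}).$$ For $t\geq 1$, $\mathcal{S}_{n}^{k}(t)$ (resp. $\mathcal{T}_{n}^{k}(t)$) denotes the set of all graphs obtained from $S_{n}^{k}$ (resp. $T_{n}^{k}$) by deleting exactly $t$ edges such that the resulting graph has minimum degree at least $3$. Also $\mathcal{S}_{n}^{k}(0)=\{S_{n}^{k}\}$ and $\mathcal{T}_{n}^{k}(0)=\{T_{n}^{k}\}$. *)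

theory Defs
  imports Complex_Main
begin

record 'a graph =
  verts :: "'a set"
  edges :: "'a set set"

definition simple_graph :: "'a graph \<Rightarrow> bool" where
  "simple_graph G \<longleftrightarrow> finite (verts G) \<and> (\<forall>e\<in>edges G. e \<subseteq> verts G \<and> card e = 2)"

definition isomorphic :: "'a graph \<Rightarrow> 'b graph \<Rightarrow> bool" where
  "isomorphic G H \<longleftrightarrow>
     (\<exists>f. bij_betw f (verts G) (verts H) \<and>
        (\<forall>u\<in>verts G. \<forall>v\<in>verts G. {u, v} \<in> edges G \<longleftrightarrow> {f u, f v} \<in> edges H))"

definition iso_mem :: "'a graph \<Rightarrow> 'b graph set \<Rightarrow> bool" where
  "iso_mem G \<F> \<longleftrightarrow> (\<exists>H\<in>\<F>. isomorphic G H)"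

definition degree :: "'a graph \<Rightarrow> 'a \<Rightarrow> nat" where
  "degree G v = card {e \<in> edges G. v \<in> e}"

(* Meaningful only for finite graphs with at least one vertex. *)
definition min_degree :: "'a graph \<Rightarrow> nat" where
  "min_degree G = Min (degree G ` verts G)"

(* A path is given by the list of its vertices in order. *)
definition is_path :: "'a graph \<Rightarrow> 'a list \<Rightarrow> bool" where
  "is_path G p \<longleftrightarrow> p \<noteq> [] \<and> distinct p \<and> set p \<subseteq> verts G \<and>
     successively (\<lambda>u v. {u, v} \<in> edges G) p"

definition connected_graph :: "'a graph \<Rightarrow> bool" where
  "connected_graph G \<longleftrightarrow> verts G \<noteq> {} \<and>
     (\<forall>u\<in>verts G. \<forall>v\<in>verts G. \<exists>p. is_path G p \<and> hd p = u \<and> last p = v)"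

definition hamilton_path :: "'a graph \<Rightarrow> 'a list \<Rightarrow> bool" where
  "hamilton_path G p \<longleftrightarrow> is_path G p \<and> set p = verts G"

definition hamilton_connected :: "'a graph \<Rightarrow> bool" where
  "hamilton_connected G \<longleftrightarrow>
     (\<forall>u\<in>verts G. \<forall>v\<in>verts G. u \<noteq> v \<longrightarrow>
        (\<exists>p. hamilton_path G p \<and> hd p = u \<and> last p = v))"

definition complete_graph :: "nat \<Rightarrow> nat graph" where
  "complete_graph n =
     \<lparr>verts = {..<n}, edges = {{u, v} | u v. u < n \<and> v < n \<and> u \<noteq> v}\<rparr>"

definition disjoint_union :: "'a graph \<Rightarrow> 'b graph \<Rightarrow> ('a + 'b) graph" where
  "disjoint_union G H =
     \<lparr>verts = verts G <+> verts H,
      edges = (`) Inl ` edges G \<union> (`) Inr ` edges H\<rparr>"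

definition join :: "'a graph \<Rightarrow> 'b graph \<Rightarrow> ('a + 'b) graph" where
  "join G H =
     \<lparr>verts = verts G <+> verts H,
      edges = edges (disjoint_union G H) \<union>
        {{Inl u, Inr v} | u v. u \<in> verts G \<and> v \<in> verts H}\<rparr>"

definition copies :: "nat \<Rightarrow> 'a graph \<Rightarrow> (nat \<times> 'a) graph" where
  "copies k G =
     \<lparr>verts = {..<k} \<times> verts G,
      edges = {Pair i ` e | i e. i < k \<and> e \<in> edges G}\<rparr>"

(* In S_graph and T_graph the parameters are meant to satisfy n >= 5 and 1 <= k <= n/2;
   in that range the natural-number subtractions do not truncate. *)
definition S_graph :: "nat \<Rightarrow> nat \<Rightarrow> (nat + nat + nat \<times> nat) graph" where
  "S_graph n k =
     join (complete_graph k)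
       (disjoint_union (complete_graph (n - (2 * k - 1))) (copies (k - 1) (complete_graph 1)))"

definition T_graph :: "nat \<Rightarrow> nat \<Rightarrow> (nat + nat + nat) graph" where
  "T_graph n k =
     join (complete_graph 2)
       (disjoint_union (complete_graph (n - (k + 1))) (complete_graph (k - 1)))"

definition delete_edges :: "'a graph \<Rightarrow> 'a set set \<Rightarrow> 'a graph" where
  "delete_edges G F = \<lparr>verts = verts G, edges = edges G - F\<rparr>"

(* The minimum degree condition is imposed only when edges are actually deleted (t >= 1). *)
definition edge_deleted :: "'a graph \<Rightarrow> nat \<Rightarrow> 'a graph set" where
  "edge_deleted G t =
     (if t = 0 then {G}
      else {delete_edges G F | F. F \<subseteq> edges G \<and> card F = t \<and> min_degree (delete_edges G F) \<ge> 3})"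

definition S_family :: "nat \<Rightarrow> nat \<Rightarrow> nat \<Rightarrow> (nat + nat + nat \<times> nat) graph set" where
  "S_family n k t = edge_deleted (S_graph n k) t"

definition T_family :: "nat \<Rightarrow> nat \<Rightarrow> nat \<Rightarrow> (nat + nat + nat) graph set" where
  "T_family n k t = edge_deleted (T_graph n k) t"

end

theory Submission
  imports Defs
begin

text \<open>
  Let \<open>G\<close> satisfy the hypotheses without being Hamilton-connected, and add edges to it as long as
  it stays so.  This gives a saturated graph \<open>H\<close> on the same \<open>n\<close> vertices (\<open>hc_saturated_extension\<close>).
  By the closure argument of Bondy and Chvatal (\<open>hamilton_connected_closure\<close>), nonadjacent vertices
  of \<open>H\<close> have degree sum at most \<open>n\<close>.  Choosing a nonadjacent pair with the largest degree sum and
  letting \<open>k\<close> be its smaller degree, one finds \<open>k - 1\<close> vertices of degree at most \<open>k\<close> and \<open>n - k\<close>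
  vertices of degree at most \<open>n - k\<close>, where \<open>3 \<le> k \<le> n / 2\<close> (\<open>hc_saturated_low_degrees\<close>).

  The \<open>k - 1\<close> vertices of small degree allow at most \<open>k (k - 1)\<close> edges that meet them and
  \<open>binomial (n - k + 1, 2)\<close> other edges.  Compared with the assumed number of edges this leaves only
  \<open>k = 3\<close>, and \<open>k = 7\<close> with \<open>n = 14\<close>, where both counts agree (\<open>extremal_parameters\<close>).

  For \<open>k = 3\<close> there are two vertices of degree \<open>3\<close>, and saturation determines \<open>H\<close> completely: it is
  \<open>S_graph n 3\<close> or \<open>T_graph n 3\<close>, which have at most \<open>2\<close> and at most \<open>1\<close> edges more than \<open>G\<close>
  (\<open>hc_saturated_two_degree_three\<close>).  For \<open>k = 7\<close> and \<open>n = 14\<close> there is no slack in the count of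
  degrees of \<open>G\<close>, which forces \<open>G\<close> to be \<open>S_graph 14 7\<close> (\<open>isomorphic_S_graph_balanced\<close>).
\<close>

section \<open>Neighbourhoods, degrees and adding an edge\<close>

definition nbrs :: "'a graph \<Rightarrow> 'a \<Rightarrow> 'a set" where
  "nbrs G v = {w. {v, w} \<in> edges G}"

definition add_edge :: "'a graph \<Rightarrow> 'a \<Rightarrow> 'a \<Rightarrow> 'a graph" where
  "add_edge G u v = \<lparr>verts = verts G, edges = insert {u, v} (edges G)\<rparr>"

lemma verts_add_edge [simp]: "verts (add_edge G u v) = verts G"
  and edges_add_edge [simp]: "edges (add_edge G u v) = insert {u, v} (edges G)"
  by (simp_all add: add_edge_def)

lemma verts_delete_edges [simp]: "verts (delete_edges G F) = verts G"
  and edges_delete_edges [simp]: "edges (delete_edges G F) = edges G - F"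
  by (simp_all add: delete_edges_def)

lemma simple_graph_edgeD:
  assumes "simple_graph G" "{u, v} \<in> edges G"
  shows "u \<in> verts G" "v \<in> verts G" "u \<noteq> v"
  using assms by (fastforce simp: simple_graph_def)+

lemma simple_graph_edgeE:
  assumes "simple_graph G" "e \<in> edges G"
  obtains u v where "e = {u, v}" "u \<noteq> v" "u \<in> verts G" "v \<in> verts G"
proof -
  have "card e = 2" "e \<subseteq> verts G"
    using assms by (auto simp: simple_graph_def)
  then show thesis
    using that by (auto simp: card_2_iff)
qed

lemma simple_graph_finite_verts: "simple_graph G \<Longrightarrow> finite (verts G)"
  by (simp add: simple_graph_def)

lemma simple_graph_finite_edges:
  assumes "simple_graph G"
  shows "finite (edges G)"
proof (rule finite_subset)
  show "edges G \<subseteq> Pow (verts G)"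
    using assms by (auto simp: simple_graph_def)
  show "finite (Pow (verts G))"
    using assms by (simp add: simple_graph_def)
qed

lemma simple_graph_add_edge:
  assumes "simple_graph G" "u \<in> verts G" "v \<in> verts G" "u \<noteq> v"
  shows "simple_graph (add_edge G u v)"
  using assms by (auto simp: simple_graph_def)

lemma simple_graph_delete_edges: "simple_graph G \<Longrightarrow> simple_graph (delete_edges G F)"
  by (auto simp: simple_graph_def)

lemma nbrs_subset: "simple_graph G \<Longrightarrow> nbrs G v \<subseteq> verts G - {v}"
  by (auto simp: nbrs_def dest: simple_graph_edgeD)

lemma finite_nbrs: "simple_graph G \<Longrightarrow> finite (nbrs G v)"
  using nbrs_subset simple_graph_finite_verts by (metis finite_Diff finite_subset)

lemma degree_eq_card_nbrs:
  assumes "simple_graph G"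
  shows "degree G v = card (nbrs G v)"
proof -
  have "bij_betw (\<lambda>w. {v, w}) (nbrs G v) {e \<in> edges G. v \<in> e}"
  proof (rule bij_betw_imageI)
    show "inj_on (\<lambda>w. {v, w}) (nbrs G v)"
      by (auto simp: inj_on_def doubleton_eq_iff)
    show "(\<lambda>w. {v, w}) ` nbrs G v = {e \<in> edges G. v \<in> e}"
    proof (intro set_eqI iffI)
      fix e assume e: "e \<in> {e \<in> edges G. v \<in> e}"
      then obtain a b where "e = {a, b}"
        using assms by (auto elim: simple_graph_edgeE)
      with e have "e = {v, if a = v then b else a}"
        by auto
      with e show "e \<in> (\<lambda>w. {v, w}) ` nbrs G v"
        unfolding nbrs_def by blast
    qed (auto simp: nbrs_def)
  qed
  then show ?thesis
    by (simp add: degree_def bij_betw_same_card)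
qed

lemma degree_mono:
  assumes "simple_graph H" "edges G \<subseteq> edges H"
  shows "degree G v \<le> degree H v"
  unfolding degree_def
  by (rule card_mono) (use assms simple_graph_finite_edges in \<open>auto intro: finite_subset\<close>)

lemma card_nonneighbours:
  assumes "simple_graph G" "v \<in> verts G"
  shows "card (verts G - {v} - nbrs G v) = card (verts G) - 1 - degree G v"
  using assms nbrs_subset[OF assms(1), of v]
  by (simp add: degree_eq_card_nbrs card_Diff_subset finite_nbrs simple_graph_finite_verts)

text \<open>Each edge either meets \<open>W\<close>, and then is counted by the degree of a vertex of \<open>W\<close>, or is
  one of the pairs outside \<open>W\<close>.  The bound is strong when \<open>W\<close> consists of vertices of low degree.\<close>

lemma card_edges_le:
  assumes "simple_graph G" "W \<subseteq> verts G"
  shows "card (edges G) \<le> (\<Sum>w\<in>W. degree G w) + (card (verts G) - card W choose 2)"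
proof -
  let ?P = "{e. e \<subseteq> verts G - W \<and> card e = 2}"
  have fin: "finite (verts G)" "finite W" "finite (edges G)"
    using assms simple_graph_finite_verts simple_graph_finite_edges finite_subset by blast+
  have "card (edges G) \<le> card ((\<Union>w\<in>W. {e \<in> edges G. w \<in> e}) \<union> ?P)"
    by (rule card_mono) (use assms fin in \<open>auto simp: simple_graph_def\<close>)
  also have "\<dots> \<le> card (\<Union>w\<in>W. {e \<in> edges G. w \<in> e}) + card ?P"
    by (rule card_Un_le)
  also have "\<dots> \<le> (\<Sum>w\<in>W. degree G w) + card ?P"
    unfolding degree_def using card_UN_le[OF fin(2)] by (simp add: add_right_mono)
  also have "card ?P = (card (verts G) - card W choose 2)"
    using fin assms by (simp add: n_subsets card_Diff_subset)
  finally show ?thesis .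
qed

section \<open>Hamilton paths and the degree-sum closure\<close>

lemma hamilton_connected_complete:
  assumes "finite (verts G)"
    and "\<And>u v. u \<in> verts G \<Longrightarrow> v \<in> verts G \<Longrightarrow> u \<noteq> v \<Longrightarrow> {u, v} \<in> edges G"
  shows "hamilton_connected G"
  unfolding hamilton_connected_def
proof (intro ballI impI)
  fix s t assume st: "s \<in> verts G" "t \<in> verts G" "s \<noteq> t"
  obtain xs where xs: "set xs = verts G - {s, t}" "distinct xs"
    using finite_distinct_list[of "verts G - {s, t}"] assms(1) by auto
  define p where "p = s # xs @ [t]"
  have p: "distinct p" "set p = verts G"
    using st xs by (auto simp: p_def)
  have "sorted_wrt (\<lambda>u v. {u, v} \<in> edges G) p"
    unfolding sorted_wrt_iff_nth_less using p assms(2)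
    by (metis distinct_conv_nth dual_order.strict_trans nth_mem order_less_irrefl)
  then have "hamilton_path G p"
    using p by (auto simp: hamilton_path_def is_path_def p_def intro: successively_if_sorted_wrt)
  then show "\<exists>p. hamilton_path G p \<and> hd p = s \<and> last p = t"
    by (intro exI[of _ p]) (simp add: p_def)
qed

lemma successively_reverse_segment:
  assumes "\<And>x y. P x y \<Longrightarrow> P y x"
    and "successively P a" "successively P m" "successively P b"
    and "a \<noteq> []" "m \<noteq> []" "b \<noteq> []" "P (last a) (last m)" "P (hd m) (hd b)"
  shows "successively P (a @ rev m @ b)"
proof -
  have "successively P (rev m)"
    using assms(3) assms(1) by (auto elim: successively_mono)
  then show ?thesis
    using assms by (simp add: successively_append_iff hd_rev last_rev)
qed

lemma successively_segment:
  assumes "\<And>k. lo \<le> k \<Longrightarrow> Suc k < hi \<Longrightarrow> P (p ! k) (p ! Suc k)" "hi \<le> length p"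
  shows "successively P (take (hi - lo) (drop lo p))"
  using assms by (auto simp: successively_conv_nth)

text \<open>The segment between the positions \<open>lo\<close> and \<open>hi\<close> is reversed, which replaces the steps
  leaving \<open>lo\<close> and \<open>hi\<close> by the two new edges; a missing edge in one of these steps is thus
  repaired.\<close>

lemma hamilton_path_reverse_segment:
  assumes p: "distinct p" "set p = verts G"
    and lohi: "lo < hi" "Suc hi < length p"
    and steps: "\<And>k. Suc k < length p \<Longrightarrow> k \<noteq> lo \<Longrightarrow> k \<noteq> hi \<Longrightarrow> {p ! k, p ! Suc k} \<in> edges G"
    and new: "{p ! lo, p ! hi} \<in> edges G" "{p ! Suc lo, p ! Suc hi} \<in> edges G"
  shows "\<exists>q. hamilton_path G q \<and> hd q = hd p \<and> last q = last p"
proof -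
  define a where "a = take (Suc lo - 0) (drop 0 p)"
  define m where "m = take (Suc hi - Suc lo) (drop (Suc lo) p)"
  define b where "b = take (length p - Suc hi) (drop (Suc hi) p)"
  have split: "p = a @ m @ b"
    unfolding a_def m_def b_def using lohi
    by (metis Suc_leI Suc_lessI append_take_drop_id diff_zero drop_0 drop_drop le_add_diff_inverse2
        less_imp_le_nat not_less_eq order_refl take_all length_drop)
  have ne: "a \<noteq> []" "m \<noteq> []" "b \<noteq> []"
    unfolding a_def m_def b_def using lohi by auto
  have ends: "last a = p ! lo" "hd m = p ! Suc lo" "last m = p ! hi" "hd b = p ! Suc hi"
    unfolding a_def m_def b_def using lohi
    by (simp_all add: take_Suc_conv_app_nth hd_drop_conv_nth last_conv_nth hd_conv_nth)
  have "successively (\<lambda>u v. {u, v} \<in> edges G) (a @ rev m @ b)"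
  proof (rule successively_reverse_segment)
    show "successively (\<lambda>u v. {u, v} \<in> edges G) a" "successively (\<lambda>u v. {u, v} \<in> edges G) m"
      "successively (\<lambda>u v. {u, v} \<in> edges G) b"
      unfolding a_def m_def b_def using lohi steps by (intro successively_segment; simp)+
  qed (use ne new ends in \<open>auto simp: insert_commute\<close>)
  moreover have "distinct (a @ rev m @ b)" "set (a @ rev m @ b) = verts G"
    using p unfolding split by auto
  ultimately have "hamilton_path G (a @ rev m @ b)"
    using ne by (auto simp: hamilton_path_def is_path_def)
  moreover have "hd (a @ rev m @ b) = hd p" "last (a @ rev m @ b) = last p"
    using ne by (simp_all add: split)
  ultimately show ?thesis by blast
qed

text \<open>The closure argument of Bondy and Chvatal.  If a Hamilton path uses the extra edge \<open>uv\<close> at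
  position \<open>i\<close>, the degree sum forces a position \<open>j\<close> with \<open>p ! j\<close> adjacent to \<open>u\<close> and
  \<open>p ! Suc j\<close> adjacent to \<open>v\<close>, and reversing the segment between \<open>i\<close> and \<open>j\<close> avoids \<open>uv\<close>.\<close>

lemma hamilton_connected_closure:
  assumes G: "simple_graph G" and uv: "u \<in> verts G" "v \<in> verts G" "u \<noteq> v" "{u, v} \<notin> edges G"
    and deg: "card (verts G) < degree G u + degree G v"
    and hc: "hamilton_connected (add_edge G u v)"
  shows "hamilton_connected G"
  unfolding hamilton_connected_def
proof (intro ballI impI)
  fix s t assume st: "s \<in> verts G" "t \<in> verts G" "s \<noteq> t"
  obtain p where p: "hamilton_path (add_edge G u v) p" "hd p = s" "last p = t"
    using hc st by (fastforce simp: hamilton_connected_def)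
  have pd: "p \<noteq> []" "distinct p" "set p = verts G"
    and steps: "\<And>k. Suc k < length p \<Longrightarrow> {p ! k, p ! Suc k} \<in> insert {u, v} (edges G)"
    using p(1) by (auto simp: hamilton_path_def is_path_def successively_conv_nth)
  show "\<exists>p. hamilton_path G p \<and> hd p = s \<and> last p = t"
  proof (cases "\<exists>i. Suc i < length p \<and> {p ! i, p ! Suc i} = {u, v}")
    case False
    then have "hamilton_path G p"
      using steps pd by (auto simp: hamilton_path_def is_path_def successively_conv_nth)
    with p show ?thesis by blast
  next
    case True
    then obtain i x y where i: "Suc i < length p" "p ! i = x" "p ! Suc i = y" and xy: "{x, y} = {u, v}"
      by blast
    have xy': "{x, y} \<notin> edges G" "x \<in> verts G" "y \<in> verts G" "x \<noteq> y"
      and deg': "card (verts G) < card (nbrs G x) + card (nbrs G y)"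
      using xy uv deg by (auto simp: doubleton_eq_iff insert_commute degree_eq_card_nbrs[OF G])
    have other: "{p ! k, p ! Suc k} \<in> edges G" if "Suc k < length p" "k \<noteq> i" for k
    proof -
      have "{p ! k, p ! Suc k} \<noteq> {x, y}"
        using that i pd(2) by (auto simp: doubleton_eq_iff nth_eq_iff_index_eq)
      with steps[OF that(1)] xy show ?thesis by auto
    qed
    define J1 where "J1 = {j. Suc j < length p \<and> p ! j \<in> nbrs G x}"
    define J2 where "J2 = {j. Suc j < length p \<and> p ! Suc j \<in> nbrs G y}"
    have len: "length p = card (verts G)"
      using pd distinct_card by fastforce
    have fin: "finite J1" "finite J2"
      unfolding J1_def J2_def by (auto intro: finite_subset[of _ "{..<length p}"])
    have "nbrs G x \<subseteq> insert (last p) ((!) p ` J1)"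
    proof
      fix w assume w: "w \<in> nbrs G x"
      then have "w \<in> set p"
        using nbrs_subset[OF G] pd by blast
      then obtain j where j: "j < length p" "p ! j = w"
        by (auto simp: in_set_conv_nth)
      show "w \<in> insert (last p) ((!) p ` J1)"
      proof (cases "Suc j < length p")
        case False
        with j have "j = length p - 1" by linarith
        with j pd show ?thesis by (simp add: last_conv_nth)
      qed (use j w in \<open>auto simp: J1_def\<close>)
    qed
    then have "card (nbrs G x) \<le> card (insert (last p) ((!) p ` J1))"
      using fin by (intro card_mono) auto
    also have "\<dots> \<le> Suc (card J1)"
      using fin by (simp add: card_insert_if card_image_le le_SucI)
    finally have J1: "card (nbrs G x) \<le> Suc (card J1)" .
    have "nbrs G y \<subseteq> insert (hd p) ((\<lambda>j. p ! Suc j) ` J2)"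
    proof
      fix w assume w: "w \<in> nbrs G y"
      then have "w \<in> set p"
        using nbrs_subset[OF G] pd by blast
      then obtain j where j: "j < length p" "p ! j = w"
        by (auto simp: in_set_conv_nth)
      show "w \<in> insert (hd p) ((\<lambda>j. p ! Suc j) ` J2)"
      proof (cases j)
        case 0
        with j pd show ?thesis by (simp add: hd_conv_nth)
      qed (use j w in \<open>auto simp: J2_def\<close>)
    qed
    then have "card (nbrs G y) \<le> card (insert (hd p) ((\<lambda>j. p ! Suc j) ` J2))"
      using fin by (intro card_mono) auto
    also have "\<dots> \<le> Suc (card J2)"
      using fin by (simp add: card_insert_if card_image_le le_SucI)
    finally have J2: "card (nbrs G y) \<le> Suc (card J2)" .
    have "x \<notin> nbrs G x" "y \<notin> nbrs G y"
      using nbrs_subset[OF G] by blast+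
    then have "J1 \<union> J2 \<subseteq> {..<length p - 1} - {i}"
      using i by (auto simp: J1_def J2_def)
    then have "card (J1 \<union> J2) \<le> card ({..<length p - 1} - {i})"
      by (intro card_mono) auto
    also have "\<dots> = length p - 2"
      using i by (simp add: card_Diff_singleton)
    finally have union: "card (J1 \<union> J2) \<le> length p - 2" .
    have "J1 \<inter> J2 \<noteq> {}"
    proof
      assume "J1 \<inter> J2 = {}"
      then have "card (J1 \<union> J2) = card J1 + card J2"
        using fin by (simp add: card_Un_disjoint)
      with union J1 J2 deg' len i show False by linarith
    qed
    then obtain j where j: "j \<in> J1" "j \<in> J2" by blast
    then have jE: "Suc j < length p" "{x, p ! j} \<in> edges G" "{y, p ! Suc j} \<in> edges G"
      by (auto simp: J1_def J2_def nbrs_def)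
    have "j \<noteq> i"
      using jE i simple_graph_edgeD(3)[OF G] by blast
    then have "min i j < max i j" "Suc (max i j) < length p"
      using i jE by auto
    moreover have "{p ! min i j, p ! max i j} \<in> edges G" "{p ! Suc (min i j), p ! Suc (max i j)} \<in> edges G"
      using jE i by (auto simp: min_def max_def insert_commute)
    moreover have "{p ! k, p ! Suc k} \<in> edges G"
      if "Suc k < length p" "k \<noteq> min i j" "k \<noteq> max i j" for k
      using other that by (auto simp: min_def max_def split: if_splits)
    ultimately show ?thesis
      using hamilton_path_reverse_segment[OF pd(2,3)] p by metis
  qed
qed

section \<open>Edge-maximal graphs that are not Hamilton-connected\<close>

definition hc_saturated :: "'a graph \<Rightarrow> bool" where
  "hc_saturated G \<longleftrightarrow> simple_graph G \<and> \<not> hamilton_connected G \<and>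
     (\<forall>u\<in>verts G. \<forall>v\<in>verts G. u \<noteq> v \<longrightarrow> {u, v} \<notin> edges G \<longrightarrow> hamilton_connected (add_edge G u v))"

lemma hc_saturated_simple: "hc_saturated G \<Longrightarrow> simple_graph G"
  by (simp add: hc_saturated_def)

lemma hc_saturated_extension:
  assumes "simple_graph G" "\<not> hamilton_connected G"
  obtains H where "hc_saturated H" "verts H = verts G" "edges G \<subseteq> edges H"
proof -
  let ?Q = "\<lambda>H. simple_graph H \<and> \<not> hamilton_connected H \<and> verts H = verts G \<and> edges G \<subseteq> edges H"
  have "card (edges H) < Suc (card (Pow (verts G)))" if "?Q H" for H
    unfolding less_Suc_eq_le
    by (rule card_mono) (use that in \<open>auto simp: simple_graph_def\<close>)
  then obtain H where H: "?Q H" and max: "\<And>K. ?Q K \<Longrightarrow> card (edges K) \<le> card (edges H)"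
    using ex_has_greatest_nat[of ?Q G "\<lambda>H. card (edges H)" "Suc (card (Pow (verts G)))"] assms
    by auto
  have "hamilton_connected (add_edge H u v)"
    if "u \<in> verts H" "v \<in> verts H" "u \<noteq> v" "{u, v} \<notin> edges H" for u v
  proof (rule ccontr)
    assume "\<not> hamilton_connected (add_edge H u v)"
    then have "card (edges (add_edge H u v)) \<le> card (edges H)"
      using that H by (intro max) (auto simp: simple_graph_add_edge)
    with that H show False
      by (simp add: simple_graph_finite_edges)
  qed
  with H that[of H] show thesis
    by (auto simp: hc_saturated_def)
qed

lemma hc_saturated_degree_sum:
  assumes "hc_saturated G" "u \<in> verts G" "v \<in> verts G" "u \<noteq> v" "{u, v} \<notin> edges G"
  shows "degree G u + degree G v \<le> card (verts G)"
  using assms hamilton_connected_closure[of G u v] unfolding hc_saturated_def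
  by (meson not_le)

text \<open>Chvatal's argument: a nonadjacent pair \<open>u\<close>, \<open>v\<close> is taken with the largest degree sum, and
  \<open>k\<close> is the smaller of its two degrees.  By maximality every nonneighbour of \<open>v\<close> has degree at
  most \<open>k\<close>, and every nonneighbour of \<open>u\<close> has degree at most the degree of \<open>v\<close>, which is at most
  \<open>card (verts G) - k\<close>.  The same bound on the degree of \<open>v\<close> provides the \<open>k - 1\<close> nonneighbours of \<open>v\<close>.\<close>

lemma hc_saturated_low_degrees:
  assumes sat: "hc_saturated G" and d: "\<And>v. v \<in> verts G \<Longrightarrow> d \<le> degree G v"
  obtains k A B where "d \<le> k" "2 * k \<le> card (verts G)"
    "A \<subseteq> verts G" "card A = k - 1" "\<And>v. v \<in> A \<Longrightarrow> degree G v \<le> k"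
    "B \<subseteq> verts G" "card B = card (verts G) - k" "\<And>v. v \<in> B \<Longrightarrow> degree G v \<le> card (verts G) - k"
proof -
  note G = hc_saturated_simple[OF sat]
  let ?Q = "\<lambda>(u, v). u \<in> verts G \<and> v \<in> verts G \<and> u \<noteq> v \<and> {u, v} \<notin> edges G"
  let ?s = "\<lambda>(u, v). degree G u + degree G v"
  have "\<exists>z. ?Q z"
  proof (rule ccontr)
    assume "\<nexists>z. ?Q z"
    then have "hamilton_connected G"
      using simple_graph_finite_verts[OF G] by (intro hamilton_connected_complete) auto
    with sat show False by (simp add: hc_saturated_def)
  qed
  then obtain z0 where "?Q z0" by blast
  moreover have "\<forall>z. ?Q z \<longrightarrow> ?s z < Suc (card (verts G))"
    using hc_saturated_degree_sum[OF sat] by (auto simp: less_Suc_eq_le)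
  ultimately obtain z where z: "?Q z" "\<And>y. ?Q y \<Longrightarrow> ?s y \<le> ?s z"
    using ex_has_greatest_nat[of ?Q z0 ?s "Suc (card (verts G))"] by blast
  obtain a b where ab: "z = (a, b)" by fastforce
  define u where "u = (if degree G a \<le> degree G b then a else b)"
  define v where "v = (if degree G a \<le> degree G b then b else a)"
  have uv: "?Q (u, v)" "degree G u \<le> degree G v" and max: "\<And>y. ?Q y \<Longrightarrow> ?s y \<le> ?s (u, v)"
    using z ab by (auto simp: u_def v_def insert_commute add.commute)
  let ?k = "degree G u"
  have sum: "?k + degree G v \<le> card (verts G)"
    using hc_saturated_degree_sum[OF sat] uv(1) by auto
  have u_less: "?k < card (verts G)"
    using sum uv d[of v] by (cases "degree G v = 0") (auto simp: card_gt_0_iff simple_graph_finite_verts[OF G])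
  have "?k - 1 \<le> card (verts G - {v} - nbrs G v)"
    using sum uv(1) by (simp add: card_nonneighbours[OF G])
  then obtain A where A: "A \<subseteq> verts G - {v} - nbrs G v" "card A = ?k - 1"
    using obtain_subset_with_card_n by metis
  let ?B = "insert u (verts G - {u} - nbrs G u)"
  show thesis
  proof (rule that[of ?k A ?B])
    show "degree G w \<le> ?k" if "w \<in> A" for w
    proof -
      have "?Q (w, v)"
        using that A(1) uv(1) by (auto simp: nbrs_def insert_commute)
      from max[OF this] show ?thesis by simp
    qed
    show "card ?B = card (verts G) - ?k"
      using card_nonneighbours[OF G, of u] uv(1) u_less
      by (simp add: simple_graph_finite_verts[OF G])
    show "degree G w \<le> card (verts G) - ?k" if "w \<in> ?B" for w
      using max[of "(u, w)"] that uv sum by (auto simp: nbrs_def)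
  qed (use uv d A sum in auto)
qed

section \<open>Isomorphisms\<close>

text \<open>A graph whose adjacency depends only on the classes of the two vertices is determined up to
  isomorphism by the class sizes.\<close>

lemma isomorphic_of_classes:
  fixes c :: "'a \<Rightarrow> 'c" and d :: "'b \<Rightarrow> 'c"
  assumes fin: "finite (verts G)" "finite (verts H)"
    and card: "\<And>i. card {v \<in> verts G. c v = i} = card {v \<in> verts H. d v = i}"
    and G: "\<And>u v. u \<in> verts G \<Longrightarrow> v \<in> verts G \<Longrightarrow> {u, v} \<in> edges G \<longleftrightarrow> u \<noteq> v \<and> R (c u) (c v)"
    and H: "\<And>u v. u \<in> verts H \<Longrightarrow> v \<in> verts H \<Longrightarrow> {u, v} \<in> edges H \<longleftrightarrow> u \<noteq> v \<and> R (d u) (d v)"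
  shows "isomorphic G H"
proof -
  have "\<forall>i. \<exists>g. bij_betw g {v \<in> verts G. c v = i} {v \<in> verts H. d v = i}"
    using fin card by (auto intro!: finite_same_card_bij)
  then obtain g where g: "\<And>i. bij_betw (g i) {v \<in> verts G. c v = i} {v \<in> verts H. d v = i}"
    by metis
  define f where "f v = g (c v) v" for v
  have f: "f v \<in> verts H" "d (f v) = c v" if "v \<in> verts G" for v
    using bij_betwE[OF g[of "c v"]] that by (auto simp: f_def)
  have inj: "inj_on f (verts G)"
  proof (rule inj_onI)
    fix u v assume uv: "u \<in> verts G" "v \<in> verts G" "f u = f v"
    then have "c u = c v"
      using f(2) by metis
    with uv show "u = v"
      using g[of "c v"] by (auto simp: f_def bij_betw_def inj_on_def)
  qed
  have "verts H \<subseteq> f ` verts G"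
  proof
    fix w assume "w \<in> verts H"
    then have "w \<in> g (d w) ` {v \<in> verts G. c v = d w}"
      using g[of "d w"] by (auto simp: bij_betw_def)
    then show "w \<in> f ` verts G"
      by (force simp: f_def)
  qed
  then have "bij_betw f (verts G) (verts H)"
    using inj f(1) by (auto simp: bij_betw_def)
  moreover have "{u, v} \<in> edges G \<longleftrightarrow> {f u, f v} \<in> edges H"
    if "u \<in> verts G" "v \<in> verts G" for u v
    using that G H f inj by (auto simp: inj_on_eq_iff)
  ultimately show ?thesis
    unfolding isomorphic_def by blast
qed

lemma isomorphic_of_parts:
  assumes fin: "finite (verts G)" "finite (verts H)"
    and G_parts: "P \<subseteq> verts G" "Z \<subseteq> verts G" "P \<inter> Z = {}"
    and H_parts: "P' \<subseteq> verts H" "Z' \<subseteq> verts H" "P' \<inter> Z' = {}"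
    and card: "card (verts G) = card (verts H)" "card P = card P'" "card Z = card Z'"
    and G: "\<And>u v. u \<in> verts G \<Longrightarrow> v \<in> verts G \<Longrightarrow>
      {u, v} \<in> edges G \<longleftrightarrow> u \<noteq> v \<and> R (u \<in> P, u \<in> Z) (v \<in> P, v \<in> Z)"
    and H: "\<And>u v. u \<in> verts H \<Longrightarrow> v \<in> verts H \<Longrightarrow>
      {u, v} \<in> edges H \<longleftrightarrow> u \<noteq> v \<and> R (u \<in> P', u \<in> Z') (v \<in> P', v \<in> Z')"
  shows "isomorphic G H"
proof (rule isomorphic_of_classes[OF fin _ G H])
  fix i :: "bool \<times> bool"
  have sizes: "card {v \<in> V. (v \<in> A, v \<in> B) = i} =
      (if i = (True, True) then 0 else if i = (True, False) then card A
       else if i = (False, True) then card B else card V - (card A + card B))"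
    if "finite V" "A \<subseteq> V" "B \<subseteq> V" "A \<inter> B = {}" for A B V :: "'c set"
  proof -
    have "{v \<in> V. (v \<in> A, v \<in> B) = i} =
      (if i = (True, True) then {} else if i = (True, False) then A
       else if i = (False, True) then B else V - (A \<union> B))"
      using that by (cases i) auto
    moreover have "card (V - (A \<union> B)) = card V - (card A + card B)"
      using that by (simp add: card_Diff_subset card_Un_disjoint finite_subset)
    ultimately show ?thesis by simp
  qed
  show "card {v \<in> verts G. (v \<in> P, v \<in> Z) = i} = card {v \<in> verts H. (v \<in> P', v \<in> Z') = i}"
    unfolding sizes[OF fin(1) G_parts] sizes[OF fin(2) H_parts] card ..
qed

lemma isomorphic_edges_image:
  assumes "simple_graph G" "simple_graph H"
    and f: "bij_betw f (verts G) (verts H)"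
      "\<forall>u\<in>verts G. \<forall>v\<in>verts G. {u, v} \<in> edges G \<longleftrightarrow> {f u, f v} \<in> edges H"
  shows "edges H = (`) f ` edges G"
proof (intro set_eqI iffI)
  fix e assume e: "e \<in> edges H"
  then obtain a b where ab: "e = {a, b}" "a \<in> verts H" "b \<in> verts H"
    using assms(2) by (auto elim: simple_graph_edgeE)
  then obtain u v where "u \<in> verts G" "v \<in> verts G" "a = f u" "b = f v"
    using bij_betw_imp_surj_on[OF f(1)] by (metis imageE)
  with ab e f(2) have "{u, v} \<in> edges G" "e = f ` {u, v}" by auto
  then show "e \<in> (`) f ` edges G" by blast
next
  fix e assume "e \<in> (`) f ` edges G"
  then show "e \<in> edges H"
    using assms by (auto elim!: simple_graph_edgeE)
qed

lemma inj_on_image_edges: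
  assumes "simple_graph G" "inj_on f (verts G)"
  shows "inj_on ((`) f) (edges G)"
  by (rule inj_on_subset[OF inj_on_image_Pow[OF assms(2)]])
    (use assms(1) in \<open>auto simp: simple_graph_def\<close>)

lemma isomorphic_min_degree:
  assumes "simple_graph G" "simple_graph H" "isomorphic G H"
  shows "min_degree H = min_degree G"
proof -
  obtain f where f: "bij_betw f (verts G) (verts H)"
    "\<forall>u\<in>verts G. \<forall>v\<in>verts G. {u, v} \<in> edges G \<longleftrightarrow> {f u, f v} \<in> edges H"
    using assms(3) by (auto simp: isomorphic_def)
  have "degree H (f v) = degree G v" if v: "v \<in> verts G" for v
  proof -
    have "f v \<in> f ` e \<longleftrightarrow> v \<in> e" if "e \<in> edges G" for e
      by (rule inj_on_image_mem_iff) (use f(1) v that assms(1) in \<open>auto simp: bij_betw_def simple_graph_def\<close>)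
    then have "{e \<in> edges H. f v \<in> e} = (`) f ` {e \<in> edges G. v \<in> e}"
      unfolding isomorphic_edges_image[OF assms(1,2) f] by auto
    moreover have "inj_on ((`) f) {e \<in> edges G. v \<in> e}"
      using inj_on_image_edges[OF assms(1) bij_betw_imp_inj_on[OF f(1)]]
      by (rule inj_on_subset) auto
    ultimately show ?thesis
      by (simp add: degree_def card_image)
  qed
  then have "degree H ` f ` verts G = degree G ` verts G"
    unfolding image_image by (rule image_cong[OF refl])
  then have "degree H ` verts H = degree G ` verts G"
    by (simp add: bij_betw_imp_surj_on[OF f(1)])
  then show ?thesis
    by (simp add: min_degree_def)
qed

text \<open>The edges deleted from \<open>H\<close> are those outside the image of \<open>G\<close> under the isomorphism.\<close>

lemma spanning_subgraph_iso_mem_edge_deleted: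
  assumes G: "simple_graph G" "min_degree G \<ge> 3"
    and K: "simple_graph K" "verts K = verts G" "edges G \<subseteq> edges K"
    and H: "simple_graph H" "isomorphic K H"
  shows "iso_mem G (edge_deleted H (card (edges K) - card (edges G)))"
proof (cases "card (edges K) - card (edges G) = 0")
  case True
  then have "edges G = edges K"
    using K simple_graph_finite_edges[OF K(1)] by (simp add: card_seteq)
  then have "isomorphic G H"
    using H(2) K(2) by (simp add: isomorphic_def)
  with True show ?thesis
    by (simp add: iso_mem_def edge_deleted_def)
next
  case False
  obtain f where f: "bij_betw f (verts K) (verts H)"
    "\<forall>u\<in>verts K. \<forall>v\<in>verts K. {u, v} \<in> edges K \<longleftrightarrow> {f u, f v} \<in> edges H"
    using H(2) by (auto simp: isomorphic_def)
  have EH: "edges H = (`) f ` edges K"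
    by (rule isomorphic_edges_image[OF K(1) H(1) f])
  have injE: "inj_on ((`) f) (edges K)"
    using inj_on_image_edges[OF K(1)] f(1) by (auto simp: bij_betw_def)
  define F where "F = (`) f ` (edges K - edges G)"
  have F: "F \<subseteq> edges H"
    by (auto simp: F_def EH)
  have "card F = card (edges K - edges G)"
    unfolding F_def by (rule card_image) (rule inj_on_subset[OF injE], auto)
  then have cardF: "card F = card (edges K) - card (edges G)"
    using K simple_graph_finite_edges[OF G(1)] by (simp add: card_Diff_subset)
  have E: "edges (delete_edges H F) = (`) f ` edges G"
    using inj_on_image_set_diff[OF injE, of "edges K" "edges K - edges G"] K(3)
    by (simp add: EH F_def double_diff)
  have iso: "isomorphic G (delete_edges H F)"
    unfolding isomorphic_def
  proof (intro exI conjI ballI)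
    show "bij_betw f (verts G) (verts (delete_edges H F))"
      using f(1) K(2) by simp
    fix u v assume uv: "u \<in> verts G" "v \<in> verts G"
    show "{u, v} \<in> edges G \<longleftrightarrow> {f u, f v} \<in> edges (delete_edges H F)"
    proof
      assume "{u, v} \<in> edges G"
      then show "{f u, f v} \<in> edges (delete_edges H F)"
        unfolding E by (rule rev_image_eqI) simp
    next
      assume "{f u, f v} \<in> edges (delete_edges H F)"
      then obtain e where e: "e \<in> edges G" "f ` e = f ` {u, v}"
        unfolding E by auto
      have "e = {u, v}"
        using inj_on_image_eq_iff[OF bij_betw_imp_inj_on[OF f(1)], of e "{u, v}"] e uv G(1) K(2)
        by (auto simp: simple_graph_def)
      with e show "{u, v} \<in> edges G" by simp
    qed
  qed
  moreover have "min_degree (delete_edges H F) \<ge> 3"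
    using isomorphic_min_degree[OF G(1) simple_graph_delete_edges[OF H(1)] iso] G(2) by simp
  ultimately show ?thesis
    using False F cardF unfolding iso_mem_def edge_deleted_def by auto
qed

section \<open>The graphs \<open>S\<close> and \<open>T\<close>\<close>

lemma simple_complete_graph: "simple_graph (complete_graph n)"
  by (auto simp: simple_graph_def complete_graph_def)

lemma simple_disjoint_union:
  "simple_graph G \<Longrightarrow> simple_graph H \<Longrightarrow> simple_graph (disjoint_union G H)"
  by (auto simp: simple_graph_def disjoint_union_def card_image)

lemma simple_join: "simple_graph G \<Longrightarrow> simple_graph H \<Longrightarrow> simple_graph (join G H)"
  using simple_disjoint_union[of G H]
  by (auto simp: simple_graph_def join_def disjoint_union_def)

lemma simple_copies: "simple_graph G \<Longrightarrow> simple_graph (copies k G)"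
  by (auto simp: simple_graph_def copies_def card_image inj_on_def)

lemma simple_S_graph: "simple_graph (S_graph n k)"
  unfolding S_graph_def
  by (intro simple_join simple_disjoint_union simple_complete_graph simple_copies)

lemma simple_T_graph: "simple_graph (T_graph n k)"
  unfolding T_graph_def
  by (intro simple_join simple_disjoint_union simple_complete_graph)

lemma simple_graph_singleton: "simple_graph G \<Longrightarrow> {v} \<notin> edges G"
  by (auto simp: simple_graph_def)

lemma edges_complete_graph_iff:
  "{u, v} \<in> edges (complete_graph n) \<longleftrightarrow> u < n \<and> v < n \<and> u \<noteq> v"
  by (auto simp: complete_graph_def doubleton_eq_iff)

lemma edges_disjoint_union_iff:
  "{Inl u, Inl v} \<in> edges (disjoint_union G H) \<longleftrightarrow> {u, v} \<in> edges G"
  "{Inr x, Inr y} \<in> edges (disjoint_union G H) \<longleftrightarrow> {x, y} \<in> edges H"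
  "{Inl u, Inr y} \<notin> edges (disjoint_union G H)"
  "{Inr y, Inl u} \<notin> edges (disjoint_union G H)"
proof -
  have l: "{Inl u, Inl v} = Inl ` e \<longleftrightarrow> e = {u, v}" for e :: "'a set"
    using inj_image_eq_iff[OF inj_Inl, of "{u, v}" e] by auto
  have r: "{Inr x, Inr y} = Inr ` e \<longleftrightarrow> e = {x, y}" for e :: "'b set"
    using inj_image_eq_iff[OF inj_Inr, of "{x, y}" e] by auto
  have "{Inl u, Inl v} \<noteq> Inr ` e" for e :: "'b set" by auto
  then show "{Inl u, Inl v} \<in> edges (disjoint_union G H) \<longleftrightarrow> {u, v} \<in> edges G"
    by (auto simp: disjoint_union_def l)
  have "{Inr x, Inr y} \<noteq> Inl ` e" for e :: "'a set" by auto
  then show "{Inr x, Inr y} \<in> edges (disjoint_union G H) \<longleftrightarrow> {x, y} \<in> edges H"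
    by (auto simp: disjoint_union_def r)
  show "{Inl u, Inr y} \<notin> edges (disjoint_union G H)" "{Inr y, Inl u} \<notin> edges (disjoint_union G H)"
    by (auto simp: disjoint_union_def)
qed

lemma edges_join_iff:
  "{Inl u, Inl v} \<in> edges (join G H) \<longleftrightarrow> {u, v} \<in> edges G"
  "{Inr x, Inr y} \<in> edges (join G H) \<longleftrightarrow> {x, y} \<in> edges H"
  "{Inl u, Inr y} \<in> edges (join G H) \<longleftrightarrow> u \<in> verts G \<and> y \<in> verts H"
  "{Inr y, Inl u} \<in> edges (join G H) \<longleftrightarrow> u \<in> verts G \<and> y \<in> verts H"
  by (auto simp: join_def edges_disjoint_union_iff doubleton_eq_iff)

lemma verts_constructions:
  "verts (complete_graph n) = {..<n}"
  "verts (disjoint_union G H) = verts G <+> verts H"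
  "verts (join G H) = verts G <+> verts H"
  "verts (copies k G) = {..<k} \<times> verts G"
  by (simp_all add: complete_graph_def disjoint_union_def join_def copies_def)

lemma edges_copies_single_vertex: "edges (copies k (complete_graph (Suc 0))) = {}"
  by (auto simp: copies_def complete_graph_def)

lemmas graph_construction_simps =
  verts_constructions edges_complete_graph_iff edges_disjoint_union_iff edges_join_iff edges_copies_single_vertex

lemma isomorphic_S_graph:
  assumes G: "simple_graph G" "card (verts G) = n" and k: "1 \<le> k" "2 * k \<le> n"
    and parts: "P \<subseteq> verts G" "Z \<subseteq> verts G" "P \<inter> Z = {}" "card P = k" "card Z = k - 1"
    and adj: "\<And>u v. u \<in> verts G \<Longrightarrow> v \<in> verts G \<Longrightarrow>
      {u, v} \<in> edges G \<longleftrightarrow> u \<noteq> v \<and> (u \<in> P \<or> v \<in> P \<or> u \<notin> Z \<and> v \<notin> Z)"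
  shows "isomorphic G (S_graph n k)"
proof -
  have V: "verts (S_graph n k) = {..<k} <+> ({..<n - (2 * k - 1)} <+> {..<k - 1} \<times> {0})"
    by (auto simp: S_graph_def verts_constructions)
  let ?P = "Inl ` {..<k} :: (nat + nat + nat \<times> nat) set"
  let ?Z = "Inr ` Inr ` ({..<k - 1} \<times> {0}) :: (nat + nat + nat \<times> nat) set"
  show ?thesis
  proof (rule isomorphic_of_parts[where P = P and Z = Z and P' = ?P and Z' = ?Z
        and R = "\<lambda>(p, z) (p', z'). p \<or> p' \<or> \<not> z \<and> \<not> z'"])
    show "card (verts G) = card (verts (S_graph n k))"
      using G(2) k by (simp add: V card_Plus)
    show "card Z = card ?Z"
      using parts(5) by (simp add: card_image)
    fix u v assume "u \<in> verts (S_graph n k)" "v \<in> verts (S_graph n k)"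
    then show "{u, v} \<in> edges (S_graph n k) \<longleftrightarrow>
        u \<noteq> v \<and> (\<lambda>(p, z) (p', z'). p \<or> p' \<or> \<not> z \<and> \<not> z') (u \<in> ?P, u \<in> ?Z) (v \<in> ?P, v \<in> ?Z)"
      using simple_graph_singleton[OF simple_S_graph[of n k]]
      unfolding V unfolding S_graph_def
      by (auto simp: graph_construction_simps)
  qed (use assms simple_graph_finite_verts simple_S_graph in \<open>auto simp: V card_image\<close>)
qed

lemma isomorphic_T_graph:
  assumes G: "simple_graph G" "card (verts G) = n" and k: "1 \<le> k" "k + 1 \<le> n"
    and parts: "P \<subseteq> verts G" "Z \<subseteq> verts G" "P \<inter> Z = {}" "card P = 2" "card Z = k - 1"
    and adj: "\<And>u v. u \<in> verts G \<Longrightarrow> v \<in> verts G \<Longrightarrow>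
      {u, v} \<in> edges G \<longleftrightarrow> u \<noteq> v \<and> (u \<in> P \<or> v \<in> P \<or> (u \<in> Z \<longleftrightarrow> v \<in> Z))"
  shows "isomorphic G (T_graph n k)"
proof -
  have V: "verts (T_graph n k) = {..<2} <+> ({..<n - (k + 1)} <+> {..<k - 1})"
    by (simp add: T_graph_def verts_constructions)
  let ?P = "Inl ` {..<2} :: (nat + nat + nat) set"
  let ?Z = "Inr ` Inr ` {..<k - 1} :: (nat + nat + nat) set"
  show ?thesis
  proof (rule isomorphic_of_parts[where P = P and Z = Z and P' = ?P and Z' = ?Z
        and R = "\<lambda>(p, z) (p', z'). p \<or> p' \<or> z = z'"])
    show "card (verts G) = card (verts (T_graph n k))"
      using G(2) k by (simp add: V card_Plus)
    show "card Z = card ?Z"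
      using parts(5) by (simp add: card_image)
    fix u v assume "u \<in> verts (T_graph n k)" "v \<in> verts (T_graph n k)"
    then show "{u, v} \<in> edges (T_graph n k) \<longleftrightarrow>
        u \<noteq> v \<and> (\<lambda>(p, z) (p', z'). p \<or> p' \<or> z = z') (u \<in> ?P, u \<in> ?Z) (v \<in> ?P, v \<in> ?Z)"
      using simple_graph_singleton[OF simple_T_graph[of n k]]
      unfolding V unfolding T_graph_def
      by (auto simp: graph_construction_simps)
  qed (use assms simple_graph_finite_verts simple_T_graph in \<open>auto simp: V card_image\<close>)
qed

section \<open>The extremal cases\<close>

lemma sum_degree_eq:
  assumes "simple_graph G"
  shows "(\<Sum>v\<in>verts G. degree G v) = 2 * card (edges G)"
proof -
  have "{v \<in> verts G. v \<in> e} = e" if "e \<in> edges G" for e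
    using that assms by (auto simp: simple_graph_def)
  then have "\<forall>e\<in>edges G. card {v \<in> verts G. v \<in> e} = 2"
    using assms by (simp add: simple_graph_def)
  then show ?thesis
    unfolding degree_def
    using sum_multicount[of "verts G" "edges G" "(\<in>)" 2] assms
    by (simp add: simple_graph_finite_verts simple_graph_finite_edges)
qed

text \<open>With \<open>2 * k\<close> vertices, the degree bounds \<open>k\<close> on \<open>B\<close> and \<open>2 * k - 1\<close> elsewhere add up to
  exactly twice the assumed number of edges.  So every bound is attained: the vertices outside \<open>B\<close>
  are adjacent to all others, which already gives each vertex of \<open>B\<close> its \<open>k\<close> neighbours.\<close>

lemma isomorphic_S_graph_balanced:
  assumes G: "simple_graph G" "card (verts G) = 2 * k" and k: "1 \<le> k"
    and m: "k * k + (k choose 2) \<le> card (edges G)"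
    and B: "B \<subseteq> verts G" "card B = k" "\<And>b. b \<in> B \<Longrightarrow> degree G b \<le> k"
  shows "isomorphic G (S_graph (2 * k) k)"
proof -
  have fin: "finite (verts G)" "finite B"
    using G B finite_subset simple_graph_finite_verts by blast+
  define bound where "bound v = (if v \<in> B then k else 2 * k - 1)" for v
  have le: "degree G v \<le> bound v" if "v \<in> verts G" for v
  proof -
    have "card (nbrs G v) \<le> card (verts G - {v})"
      using fin nbrs_subset[OF G(1)] by (intro card_mono) auto
    then show ?thesis
      using that B G by (auto simp: bound_def degree_eq_card_nbrs)
  qed
  have cB: "card (verts G - B) = k"
    using B G fin by (simp add: card_Diff_subset)
  have "(\<Sum>v\<in>verts G. bound v) = (\<Sum>v\<in>verts G - B. bound v) + (\<Sum>v\<in>B. bound v)"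
    using fin B by (simp add: sum.subset_diff)
  also have "\<dots> = k * (2 * k - 1) + k * k"
    using cB B(2) by (simp add: bound_def)
  also have "\<dots> = 2 * (k * k + (k choose 2))"
    using k by (cases k) (auto simp: choose_two algebra_simps)
  finally have "(\<Sum>v\<in>verts G. bound v) \<le> (\<Sum>v\<in>verts G. degree G v)"
    using m by (simp add: sum_degree_eq[OF G(1)])
  moreover have "(\<Sum>v\<in>verts G. degree G v) \<le> (\<Sum>v\<in>verts G. bound v)"
    using le by (rule sum_mono)
  ultimately have "(\<Sum>v\<in>verts G. degree G v) = (\<Sum>v\<in>verts G. bound v)"
    by linarith
  then have tight: "degree G v = bound v" if "v \<in> verts G" for v
    using sum_mono_inv[of "degree G" "verts G" bound v] le that fin by blast
  have full: "nbrs G v = verts G - {v}" if "v \<in> verts G - B" for v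
    using tight[of v] that fin G nbrs_subset[OF G(1), of v]
    by (intro card_subset_eq) (auto simp: bound_def degree_eq_card_nbrs)
  have indep: "nbrs G b = verts G - B" if b: "b \<in> B" for b
  proof (rule sym, rule card_subset_eq)
    show "verts G - B \<subseteq> nbrs G b"
    proof
      fix v assume v: "v \<in> verts G - B"
      then have "b \<in> nbrs G v"
        using full b B(1) by auto
      then show "v \<in> nbrs G b"
        by (simp add: nbrs_def insert_commute)
    qed
    show "card (verts G - B) = card (nbrs G b)"
      using tight[of b] b B(1) cB by (auto simp: bound_def degree_eq_card_nbrs[OF G(1)])
  qed (rule finite_nbrs[OF G(1)])
  \<comment> \<open>In \<open>S_graph (2 * k) k\<close> the middle clique is a single vertex, so one vertex of the
    independent set \<open>B\<close> plays its part.\<close>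
  obtain b where b: "b \<in> B"
    using B(2) k by fastforce
  show ?thesis
  proof (rule isomorphic_S_graph[where P = "verts G - B" and Z = "B - {b}"])
    show "card (B - {b}) = k - 1"
      using b B(2) by simp
    fix u v assume uv: "u \<in> verts G" "v \<in> verts G"
    have "{u, v} \<in> edges G \<longleftrightarrow> v \<in> nbrs G u"
      by (simp add: nbrs_def)
    also have "\<dots> \<longleftrightarrow> u \<noteq> v \<and> (u \<in> verts G - B \<or> v \<in> verts G - B)"
      using uv full[of u] indep[of u] by (cases "u \<in> B") auto
    also have "\<dots> \<longleftrightarrow> u \<noteq> v \<and> (u \<in> verts G - B \<or> v \<in> verts G - B \<or> u \<notin> B - {b} \<and> v \<notin> B - {b})"
      using uv by auto
    finally show "{u, v} \<in> edges G \<longleftrightarrow>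
      u \<noteq> v \<and> (u \<in> verts G - B \<or> v \<in> verts G - B \<or> u \<notin> B - {b} \<and> v \<notin> B - {b})" .
  qed (use G k B cB in auto)
qed

lemma choose_two_Suc_Suc: "Suc (Suc j) choose 2 = (j choose 2) + 2 * j + 1"
  by (simp add: numeral_2_eq_2)

text \<open>In a saturated graph nonadjacent degrees add up to at most \<open>n\<close>.  Hence two nonadjacent
  vertices besides \<open>x\<close> and \<open>y\<close> would, together with \<open>x\<close> and \<open>y\<close>, meet too few edges, so all these
  vertices form a clique.  A vertex of the clique that is adjacent to \<open>y\<close> but not to \<open>x\<close> would have
  degree at least \<open>n - 2\<close>, giving the sum \<open>n + 1\<close> with \<open>x\<close>.  So \<open>x\<close> and \<open>y\<close> have the same
  neighbours in the clique, three or two of them according to whether \<open>x\<close> and \<open>y\<close> are adjacent.\<close>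

lemma hc_saturated_two_degree_three:
  assumes sat: "hc_saturated G" and n: "card (verts G) = n" "10 \<le> n"
    and m: "((n - 2) choose 2) + 4 \<le> card (edges G)"
    and d: "\<And>v. v \<in> verts G \<Longrightarrow> 3 \<le> degree G v"
    and xy: "x \<in> verts G" "y \<in> verts G" "x \<noteq> y" "degree G x \<le> 3" "degree G y \<le> 3"
  shows "isomorphic G (S_graph n 3) \<and> card (edges G) \<le> ((n - 2) choose 2) + 6 \<or>
    isomorphic G (T_graph n 3) \<and> card (edges G) \<le> ((n - 2) choose 2) + 5"
proof -
  note G = hc_saturated_simple[OF sat]
  note fin = simple_graph_finite_verts[OF G]
  have dxy: "degree G x = 3" "degree G y = 3"
    using d[of x] d[of y] xy by auto
  have clique: "{u, v} \<in> edges G" if "u \<in> verts G - {x, y}" "v \<in> verts G - {x, y}" "u \<noteq> v" for u v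
  proof (rule ccontr)
    assume uv: "{u, v} \<notin> edges G"
    then have "degree G u + degree G v \<le> n"
      using hc_saturated_degree_sum[OF sat] that n by auto
    moreover have "card (edges G) \<le> (\<Sum>w\<in>{x, y, u, v}. degree G w) + (n - card {x, y, u, v} choose 2)"
      using card_edges_le[OF G, of "{x, y, u, v}"] that(1,2) xy(1,2) n(1) by auto
    moreover have "(\<Sum>w\<in>{x, y, u, v}. degree G w) = 6 + (degree G u + degree G v)"
      "card {x, y, u, v} = 4"
      using that xy(3) dxy by auto
    ultimately have "card (edges G) \<le> 6 + n + (n - 4 choose 2)"
      by simp
    moreover obtain j where j: "n = 4 + j"
      using n(2) le_Suc_ex[of 4 n] by auto
    then have "n - 2 choose 2 = (n - 4 choose 2) + 2 * j + 1"
      using choose_two_Suc_Suc[of j] by simp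
    ultimately show False
      using m n(2) j by linarith
  qed
  have sub: "nbrs G b - {a} \<subseteq> nbrs G a" if ab: "a = x \<and> b = y \<or> a = y \<and> b = x" for a b
  proof
    fix r assume r: "r \<in> nbrs G b - {a}"
    have rV: "r \<in> verts G - {x, y}"
      using r ab nbrs_subset[OF G, of b] by auto
    show "r \<in> nbrs G a"
    proof (rule ccontr)
      assume "r \<notin> nbrs G a"
      then have nonadj: "{a, r} \<notin> edges G"
        by (simp add: nbrs_def)
      have "verts G - {a, r} \<subseteq> nbrs G r"
        using r clique[OF rV] ab by (auto simp: nbrs_def insert_commute)
      then have "card (verts G - {a, r}) \<le> degree G r"
        by (simp add: degree_eq_card_nbrs[OF G] card_mono finite_nbrs[OF G])
      moreover have "card (verts G - {a, r}) = n - 2"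
        using rV ab xy n fin by (auto simp: card_Diff_subset)
      moreover have "degree G a + degree G r \<le> n"
        using hc_saturated_degree_sum[OF sat _ _ _ nonadj] rV ab xy n by auto
      ultimately show False
        using ab dxy n(2) by auto
    qed
  qed
  define P where "P = nbrs G x - {y}"
  have P: "P \<subseteq> verts G - {x, y}"
    using nbrs_subset[OF G, of x] by (auto simp: P_def)
  have nx: "{x, w} \<in> edges G \<longleftrightarrow> w \<in> P \<or> w = y \<and> {x, y} \<in> edges G" for w
    by (auto simp: P_def nbrs_def)
  have ny: "{y, w} \<in> edges G \<longleftrightarrow> w \<in> P \<or> w = x \<and> {x, y} \<in> edges G" for w
    using sub[of x y] sub[of y x] P nbrs_subset[OF G, of y]
    by (auto simp: P_def nbrs_def insert_commute)
  have adj: "{u, v} \<in> edges G \<longleftrightarrow>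
      u \<noteq> v \<and> (u \<in> P \<or> v \<in> P \<or> u \<notin> {x, y} \<and> v \<notin> {x, y} \<or>
        u \<in> {x, y} \<and> v \<in> {x, y} \<and> {x, y} \<in> edges G)"
    if uv: "u \<in> verts G" "v \<in> verts G" for u v
  proof (cases "u = v")
    case False
    consider "u = x" | "u = y" | "v = x" | "v = y" | "u \<notin> {x, y}" "v \<notin> {x, y}"
      by auto
    then show ?thesis
      using P nx[of v] ny[of v] nx[of u] ny[of u] clique[of u v] uv False xy(3)
      by cases (auto simp: insert_commute)
  qed (use simple_graph_singleton[OF G] in simp)
  show ?thesis
  proof (cases "{x, y} \<in> edges G")
    case False
    then have "P = nbrs G x"
      by (auto simp: P_def nbrs_def)
    then have "card P = 3"
      using dxy by (simp add: degree_eq_card_nbrs[OF G])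
    then have "isomorphic G (S_graph n 3)"
      using P xy n adj False
      by (intro isomorphic_S_graph[where P = P and Z = "{x, y}"] G) auto
    moreover have "card (edges G) \<le> ((n - 2) choose 2) + 6"
    proof -
      have "card {x, y} = 2" "(\<Sum>w\<in>{x, y}. degree G w) = 6"
        using xy(3) dxy by auto
      then show ?thesis
        using card_edges_le[OF G, of "{x, y}"] xy(1,2) n(1) by (simp add: add.commute)
    qed
    ultimately show ?thesis by blast
  next
    case True
    \<comment> \<open>The edge \<open>xy\<close> would be counted at both of its ends; it is removed before counting.\<close>
    let ?H = "delete_edges G {{x, y}}"
    have H: "simple_graph ?H"
      using G by (rule simple_graph_delete_edges)
    have "{x, w} \<in> edges G \<longleftrightarrow> w \<in> P \<or> w = y" "{y, w} \<in> edges G \<longleftrightarrow> w \<in> P \<or> w = x" for w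
      using nx[of w] ny[of w] True by blast+
    then have Hn: "nbrs ?H x = P" "nbrs ?H y = P"
      using P by (auto simp: nbrs_def doubleton_eq_iff)
    have "y \<in> nbrs G x"
      using True by (simp add: nbrs_def)
    then have cP: "card P = 2"
      using dxy by (simp add: P_def degree_eq_card_nbrs[OF G])
    then have "isomorphic G (T_graph n 3)"
      using P xy n adj True
      by (intro isomorphic_T_graph[where P = P and Z = "{x, y}"] G) auto
    moreover have "card (edges ?H) \<le> 4 + (n - 2 choose 2)"
    proof -
      have "card {x, y} = 2" "(\<Sum>w\<in>{x, y}. degree ?H w) = 4"
        using xy(3) Hn cP by (auto simp: degree_eq_card_nbrs[OF H])
      then show ?thesis
        using card_edges_le[OF H, of "{x, y}"] xy(1,2) n(1) by simp
    qed
    moreover have "card (edges ?H) = card (edges G) - 1"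
      using True by simp
    ultimately show ?thesis by linarith
  qed
qed

section \<open>The edge condition\<close>

text \<open>In doubled form the difference of the two sides is
  \<open>4 - (k - 3) * (2 * n - 6 - 3 * k)\<close>.  By \<open>2 * k \<le> n\<close> and \<open>14 \<le> n\<close> the second factor is at least
  \<open>n / 2 - 6 \<ge> 1\<close>, so the difference is negative for \<open>k \<ge> 8\<close>.  Of the remaining values above \<open>3\<close>
  only \<open>k = 7\<close> with \<open>n = 14\<close> keeps the product down to \<open>4\<close>.\<close>

lemma extremal_parameters:
  fixes n k :: nat
  assumes "14 \<le> n" "3 \<le> k" "2 * k \<le> n"
    and le: "((n - 2) choose 2) + 4 \<le> (k - 1) * k + ((n - (k - 1)) choose 2)"
  shows "k = 3 \<or> n = 14 \<and> k = 7"
proof -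
  define N K where "N = int n" and "K = int k"
  have two: "2 * int (a choose 2) = int a * (int a - 1)" for a
    by (induction a) (auto simp: numeral_2_eq_2 algebra_simps)
  have NK: "int (n - 2) = N - 2" "int (n - (k - 1)) = N - K + 1" "int (k - 1) = K - 1"
    using assms by (auto simp: N_def K_def)
  have "int (((n - 2) choose 2) + 4) \<le> int ((k - 1) * k + ((n - (k - 1)) choose 2))"
    using le by (simp only: of_nat_le_iff)
  then have "(N - 2) * (N - 3) + 8 \<le> 2 * ((K - 1) * K) + (N - K + 1) * (N - K)"
    using two[of "n - 2"] two[of "n - (k - 1)"]
    unfolding of_nat_add of_nat_mult NK K_def[symmetric] by (simp add: algebra_simps)
  then have prod: "(K - 3) * (2 * N - 6 - 3 * K) \<le> 4"
    by (simp add: algebra_simps)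
  have bounds: "14 \<le> N" "3 \<le> K" "2 * K \<le> N"
    using assms by (auto simp: N_def K_def)
  have "K \<le> 7"
  proof (rule ccontr)
    assume "\<not> K \<le> 7"
    then have "5 * 1 \<le> (K - 3) * (2 * N - 6 - 3 * K)"
      using bounds by (intro mult_mono) auto
    with prod show False by simp
  qed
  then have "K = 3 \<or> K = 4 \<or> K = 5 \<or> K = 6 \<or> K = 7"
    using bounds by auto
  then have "K = 3 \<or> N = 14 \<and> K = 7"
    using prod bounds by auto
  then show ?thesis
    by (auto simp: N_def K_def)
qed

theorem corollary1p4:
  fixes G :: "'a graph" and n m :: nat
  assumes "simple_graph G"
    and "connected_graph G"
    and "card (verts G) = n" and "n \<ge> 14"
    and "card (edges G) = m"
    and "min_degree G \<ge> 3"
    and "m \<ge> ((n - 2) choose 2) + 4"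
  shows "hamilton_connected G \<or>
     iso_mem G (\<Union>i\<in>{0..2}. S_family n 3 i) \<or>
     iso_mem G (\<Union>i\<in>{0..1}. T_family n 3 i) \<or>
     (n = 14 \<and> isomorphic G (S_graph 14 7))"
proof (cases "hamilton_connected G")
  case False
  obtain H where sat: "hc_saturated H" and H: "verts H = verts G" "edges G \<subseteq> edges H"
    using hc_saturated_extension[OF assms(1) False] .
  note simple_H = hc_saturated_simple[OF sat]
  have deg_le: "degree G v \<le> degree H v" for v
    using degree_mono[OF simple_H H(2)] .
  have "min_degree G \<le> degree G v" if "v \<in> verts G" for v
    unfolding min_degree_def
    using that simple_graph_finite_verts[OF assms(1)] by (intro Min_le) auto
  then have d: "3 \<le> degree H v" if "v \<in> verts H" for v
    using that H(1) deg_le[of v] assms(6) by (metis order_trans)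
  have mH: "m \<le> card (edges H)"
    using H(2) assms(5) simple_graph_finite_edges[OF simple_H] by (auto intro: card_mono)
  obtain k A B where k: "3 \<le> k" "2 * k \<le> n"
    and A: "A \<subseteq> verts H" "card A = k - 1" "\<And>v. v \<in> A \<Longrightarrow> degree H v \<le> k"
    and B: "B \<subseteq> verts H" "card B = n - k" "\<And>v. v \<in> B \<Longrightarrow> degree H v \<le> n - k"
    using hc_saturated_low_degrees[OF sat d] assms(3) H(1) by metis
  have "card (edges H) \<le> (\<Sum>v\<in>A. degree H v) + ((n - (k - 1)) choose 2)"
    using card_edges_le[OF simple_H A(1)] A(2) assms(3) H(1) by simp
  also have "(\<Sum>v\<in>A. degree H v) \<le> (k - 1) * k"
    using sum_bounded_above[of A "degree H" k] A by simp
  finally have "((n - 2) choose 2) + 4 \<le> (k - 1) * k + ((n - (k - 1)) choose 2)"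
    using mH assms(7) by simp
  then consider "k = 3" | "n = 14" "k = 7"
    using extremal_parameters[OF assms(4) k] by blast
  then show ?thesis
  proof cases
    case 1
    \<comment> \<open>Here \<open>H\<close> is one of the two extremal graphs, and \<open>G\<close> arises from it by deleting edges.\<close>
    then obtain x y where "A = {x, y}" "x \<noteq> y"
      using A(2) by (auto simp: card_2_iff)
    then have xy: "x \<in> verts H" "y \<in> verts H" "x \<noteq> y" "degree H x \<le> 3" "degree H y \<le> 3"
      using A 1 by auto
    have fam: "iso_mem G (edge_deleted K (card (edges H) - m))"
      if "simple_graph K" "isomorphic H K" for K :: "'b graph"
      using spanning_subgraph_iso_mem_edge_deleted[OF assms(1,6) simple_H H that] assms(5) by simp
    have "isomorphic H (S_graph n 3) \<and> card (edges H) \<le> ((n - 2) choose 2) + 6 \<or>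
        isomorphic H (T_graph n 3) \<and> card (edges H) \<le> ((n - 2) choose 2) + 5"
      by (rule hc_saturated_two_degree_three[OF sat _ _ _ d xy])
        (use assms(3,4,7) H(1) mH in auto)
    then show ?thesis
    proof (elim disjE conjE)
      assume "isomorphic H (S_graph n 3)" "card (edges H) \<le> ((n - 2) choose 2) + 6"
      then have "iso_mem G (S_family n 3 (card (edges H) - m))" "card (edges H) - m \<in> {0..2}"
        using fam[OF simple_S_graph] assms(7) by (auto simp: S_family_def)
      then show ?thesis by (auto simp: iso_mem_def)
    next
      assume "isomorphic H (T_graph n 3)" "card (edges H) \<le> ((n - 2) choose 2) + 5"
      then have "iso_mem G (T_family n 3 (card (edges H) - m))" "card (edges H) - m \<in> {0..1}"
        using fam[OF simple_T_graph] assms(7) by (auto simp: T_family_def)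
      then show ?thesis by (auto simp: iso_mem_def)
    qed
  next
    case 2
    \<comment> \<open>The degrees in \<open>G\<close> are at most those in \<open>H\<close>, so the rigidity applies to \<open>G\<close> itself.\<close>
    have "isomorphic G (S_graph (2 * 7) 7)"
    proof (rule isomorphic_S_graph_balanced)
      show "7 * 7 + (7 choose 2) \<le> card (edges G)"
        using assms(5,7) 2 by (simp add: choose_two)
      show "degree G b \<le> 7" if "b \<in> B" for b
        using B(3)[OF that] 2 deg_le[of b] by simp
    qed (use assms(1,3) 2 B H in auto)
    with 2 show ?thesis by simp
  qed
qed simp

end
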